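(* Let $I\subset\mathbb{R}$ be an open bounded interval, $U\subset\mathbb{R}^2$ an open set, and $\Phi\in C^2(I\times U)$ a real-valued function; write $\Phi_\alpha(x)=\Phi(\alpha,x)$. Assume there is a constant $C_0\ge 1$ such that for all $\alpha\in I$ and $x\in U$: (1) $C_0^{-1}\le |\nabla\Phi_\alpha(x)|\le C_0$; (2) $|\partial_i\partial_j\Phi_\alpha(x)|\le C_0$ for all $i,j\in\{1,2\}$; (3) $C_0^{-1}\le\left|\det\begin{pmatrix}\partial_1\Phi_\alpha(x)&\partial_\alpha\partial_1\Phi_\alpha(x)\\ \partial_2\Phi_\alpha(x)&\partial_\alpha\partial_2\Phi_\alpha(x)\end{pmatrix}\right|\le C_0$. Let $V\subset U$ be a fixed compact set and let $M\in\mathbb{N}$. Then there exist $\delta_0>0$ (depending only on $\Phi,V,I$) and a constant $c>0$ (depending only on $\Phi,U,V,I$ and $M$) such that the following holds. Let $Q\subset V$ be a compact square of side length $\delta<\delta_0$, and let $E\subset Q$ be a union of finitely many compact squares of side length $\delta^2$. Assume in addition that (a) for every $\alpha\in I$ and every $y\in\mathbb{R}$, the set $Q\cap\Phi_\alpha^{-1}(y)$ has at most $M$ connected components; (b) $\Theta\subset[0,2\pi]$ is an interval such that, for some point $x_0\in Q$, $\Theta\subset\{\theta_\alpha(x_0):\alpha\in I\}$. Then $$\mathrm{Fav}_\Phi(E)\ge c\int_\Theta|\pi_\theta(E)|\,d\theta.$$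
   Context: Here $\nabla$, $\partial_1,\partial_2$ are derivatives in the variable $x\in U$, and $|\cdot|$ of a subset of $\mathbb{R}$ is Lebesgue measure. The generalized Favard length of $E\subset U$ is $\mathrm{Fav}_\Phi(E)=\int_I|\Phi_\alpha(E)|\,d\alpha$. The orthogonal projections are $\pi_\theta(x)=x_1\cos\theta+x_2\sin\theta$. The angle $\theta_\alpha(x)$ is defined (modulo $2\pi$) by $(\cos\theta_\alpha(x),\sin\theta_\alpha(x))=\nabla\Phi_\alpha(x)/|\nabla\Phi_\alpha(x)|$; thus (b) means that for every $\theta\in\Theta$ there is $\alpha\in I$ with $(\cos\theta,\sin\theta)=\nabla\Phi_\alpha(x_0)/|\nabla\Phi_\alpha(x_0)|$. Squares may have any orientation. *)

theory Defs
  imports "HOL-Analysis.Analysis"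
begin

text \<open>
  Intended for open \<open>S\<close>. On an open set, \<open>C\<^sup>1\<close> in terms of partial derivatives implies
  Frechet differentiability; differentiability is listed explicitly so that
  \<^const>\<open>frechet_derivative\<close>, applied to a basis vector, is the partial derivative.
\<close>

primrec Ck_on :: "nat \<Rightarrow> 'a::euclidean_space set \<Rightarrow> ('a \<Rightarrow> real) \<Rightarrow> bool" where
  "Ck_on 0 S f \<longleftrightarrow> continuous_on S f"
| "Ck_on (Suc k) S f \<longleftrightarrow>
     (\<forall>x\<in>S. f differentiable (at x)) \<and>
     (\<forall>b\<in>Basis. Ck_on k S (\<lambda>x. frechet_derivative f (at x) b))"

definition partial :: "2 \<Rightarrow> (real^2 \<Rightarrow> real) \<Rightarrow> real^2 \<Rightarrow> real" where
  "partial i f x = frechet_derivative f (at x) (axis i 1)"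

definition grad :: "(real^2 \<Rightarrow> real) \<Rightarrow> real^2 \<Rightarrow> real^2" where
  "grad f x = (\<chi> i. partial i f x)"

definition partial_param :: "2 \<Rightarrow> (real \<Rightarrow> real^2 \<Rightarrow> real) \<Rightarrow> real \<Rightarrow> real^2 \<Rightarrow> real" where
  "partial_param i \<Phi> \<alpha> x = deriv (\<lambda>a. partial i (\<Phi> a) x) \<alpha>"

definition jac_matrix :: "(real \<Rightarrow> real^2 \<Rightarrow> real) \<Rightarrow> real \<Rightarrow> real^2 \<Rightarrow> real^2^2" where
  "jac_matrix \<Phi> \<alpha> x =
     vector [vector [partial 1 (\<Phi> \<alpha>) x, partial_param 1 \<Phi> \<alpha> x],
             vector [partial 2 (\<Phi> \<alpha>) x, partial_param 2 \<Phi> \<alpha> x]]"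

text \<open>
  Integrals and Lebesgue measures are taken in \<open>[0, \<infinity>]\<close>, so no integrability convention enters.
\<close>

definition Fav :: "real set \<Rightarrow> (real \<Rightarrow> real^2 \<Rightarrow> real) \<Rightarrow> (real^2) set \<Rightarrow> ennreal" where
  "Fav I \<Phi> E = (\<integral>\<^sup>+\<alpha>\<in>I. emeasure lebesgue (\<Phi> \<alpha> ` E) \<partial>lebesgue)"

definition proj :: "real \<Rightarrow> real^2 \<Rightarrow> real" where
  "proj \<theta> x = x $ 1 * cos \<theta> + x $ 2 * sin \<theta>"

text \<open>
  The angle of the gradient is only defined modulo \<open>2\<pi>\<close>, hence a relation: \<open>\<theta>\<close> is one of the
  values of the angle of \<open>\<nabla>\<Phi>\<^sub>\<alpha>(x)\<close>.
\<close>

definition is_grad_angle :: "(real \<Rightarrow> real^2 \<Rightarrow> real) \<Rightarrow> real \<Rightarrow> real^2 \<Rightarrow> real \<Rightarrow> bool" where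
  "is_grad_angle \<Phi> \<alpha> x \<theta> \<longleftrightarrow>
     vector [cos \<theta>, sin \<theta>] = grad (\<Phi> \<alpha>) x /\<^sub>R norm (grad (\<Phi> \<alpha>) x)"

text \<open>Closed squares of side length \<open>s\<close> in arbitrary position and orientation.\<close>

definition is_square :: "real \<Rightarrow> (real^2) set \<Rightarrow> bool" where
  "is_square s Q \<longleftrightarrow> 0 < s \<and>
     (\<exists>(a :: real^2) (f :: real^2 \<Rightarrow> real^2). orthogonal_transformation f \<and>
       Q = (\<lambda>x. a + f x) ` cbox 0 (\<chi> i. s))"

end

theory Submission
  imports Defs
begin

text \<open>
  Fix \<open>\<alpha>\<close>, let \<open>\<theta>\<close> be the angle of \<open>\<nabla>\<Phi>\<^sub>\<alpha>(x\<^sub>0)\<close> and \<open>g\<close> its length. By Taylor's formula on \<open>Q\<close>,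
  \<open>\<Phi>\<^sub>\<alpha>\<close> differs from the affine function \<open>p = g \<pi>\<^sub>\<theta> + const\<close> by \<open>O(\<delta>\<^sup>2)\<close>, while the image under \<open>\<Phi>\<^sub>\<alpha>\<close>
  of each square of side \<open>\<delta>\<^sup>2\<close> contains an interval of length \<open>L\<close> comparable to \<open>\<delta>\<^sup>2\<close>. Hence \<open>p(E)\<close> is
  covered by boundedly many translates of \<open>\<Phi>\<^sub>\<alpha>(E)\<close> by multiples of \<open>L\<close>, so \<open>|\<pi>\<^sub>\<theta>(E)| \<le> K |\<Phi>\<^sub>\<alpha>(E)|\<close>.
  Finally \<open>\<alpha> \<mapsto> \<theta>\<^sub>\<alpha>(x\<^sub>0)\<close> has derivative \<open>det / |\<nabla>\<Phi>\<^sub>\<alpha>(x\<^sub>0)|\<^sup>2\<close>, which is bounded. Off the branch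
  cut, it is a genuine function, and Lebesgue measure on \<open>\<Theta>\<close> is dominated by a constant times its
  push-forward of Lebesgue measure; neither injectivity nor a continuous lift of the angle is needed.
\<close>

section \<open>Measure of images under real maps with bounded derivative\<close>

lemma lmeasurable_vec1_iff:
  fixes T :: "(real^1) set"
  shows "T \<in> lmeasurable \<longleftrightarrow> (\<lambda>x. x $ 1) ` T \<in> lmeasurable"
  unfolding lmeasurable_iff_integrable_on integrable_on_def
  using has_integral_vec1_I[of "\<lambda>_. 1::real" _ T] has_integral_vec1_D[of "\<lambda>_. 1::real" _ T]
  by (auto simp: o_def)

lemma measure_lebesgue_vec1:
  fixes T :: "(real^1) set"
  assumes "T \<in> lmeasurable"
  shows "measure lebesgue ((\<lambda>x. x $ 1) ` T) = measure lebesgue T"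
  using assms integral_vec1_eq[of T "\<lambda>_. 1::real"]
  by (simp add: lmeasurable_vec1_iff lmeasure_integral o_def)

text \<open>This is the case n = 1 of the change-of-variables bound for differentiable maps of
  real^n. Conjugating with \<open>vec\<close> and \<open>$ 1\<close> turns \<open>f\<close> into a
  self-map of \<open>real^1\<close> whose derivative is scaling by \<open>f'\<close>, with Jacobian
  determinant \<open>f'\<close>.\<close>

lemma lmeasurable_bounded_derivative_image:
  fixes f f' :: "real \<Rightarrow> real"
  assumes S: "S \<in> lmeasurable"
    and der: "\<And>x. x \<in> S \<Longrightarrow> (f has_real_derivative f' x) (at x within S)"
    and bound: "\<And>x. x \<in> S \<Longrightarrow> \<bar>f' x\<bar> \<le> B"
  shows "f ` S \<in> lmeasurable" (is ?meas)
    and "measure lebesgue (f ` S) \<le> B * measure lebesgue S" (is ?le)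
proof -
  let ?lift = "vec :: real \<Rightarrow> real^1" and ?drop = "\<lambda>x::real^1. x $ 1"
  have drop_lift: "?drop ` ?lift ` X = X" for X
    by (simp add: image_image)
  have S': "?lift ` S \<in> lmeasurable"
    using S by (simp add: lmeasurable_vec1_iff drop_lift)
  have "((\<lambda>x. ?lift (f (x $ 1))) has_derivative (*\<^sub>R) (f' z)) (at (?lift z) within ?lift ` S)"
    if "z \<in> S" for z
    using der[OF that] by (intro has_derivative_vector_1) (simp add: has_field_derivative_def mult.commute[of _ "f' z"])
  then have der': "\<And>x. x \<in> ?lift ` S \<Longrightarrow>
      ((\<lambda>x. ?lift (f (x $ 1))) has_derivative (*\<^sub>R) (f' (?drop x))) (at x within ?lift ` S)"
    by auto
  have det: "\<bar>det (matrix ((*\<^sub>R) c :: real^1 \<Rightarrow> real^1))\<bar> = \<bar>c\<bar>" for c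
    by (simp add: matrix_def det_1 axis_def)
  have int: "(\<lambda>x. \<bar>det (matrix ((*\<^sub>R) (f' (?drop x)) :: real^1 \<Rightarrow> real^1))\<bar>) integrable_on ?lift ` S"
  proof (rule measurable_bounded_by_integrable_imp_integrable)
    show "(\<lambda>x. \<bar>det (matrix ((*\<^sub>R) (f' (?drop x)) :: real^1 \<Rightarrow> real^1))\<bar>)
        \<in> borel_measurable (lebesgue_on (?lift ` S))"
      using borel_measurable_det_Jacobian[OF fmeasurableD[OF S'] der'] by measurable
    show "(\<lambda>_. B) integrable_on ?lift ` S"
      using S' by (simp add: integrable_on_const)
    show "\<And>x. x \<in> ?lift ` S \<Longrightarrow>
        norm \<bar>det (matrix ((*\<^sub>R) (f' (?drop x)) :: real^1 \<Rightarrow> real^1))\<bar> \<le> B"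
      using bound by (auto simp: det)
    show "?lift ` S \<in> sets lebesgue"
      using S' by (rule fmeasurableD)
  qed
  have bd: "\<And>x. x \<in> ?lift ` S \<Longrightarrow> \<bar>det (matrix ((*\<^sub>R) (f' (?drop x)) :: real^1 \<Rightarrow> real^1))\<bar> \<le> B"
    using bound by (auto simp: det)
  have img: "(\<lambda>x. ?lift (f (x $ 1))) ` ?lift ` S = ?lift ` f ` S"
    by (simp add: image_image)
  have "?lift ` f ` S \<in> lmeasurable"
    using measurable_bounded_differentiable_image[OF S' der' int bd] by (simp only: img)
  then show ?meas
    by (simp add: lmeasurable_vec1_iff drop_lift)
  have "measure lebesgue (?lift ` f ` S) \<le> B * measure lebesgue (?lift ` S)"
    using measure_bounded_differentiable_image[OF S' der' int bd] by (simp only: img)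
  then show ?le
    using measure_lebesgue_vec1[OF S'] measure_lebesgue_vec1[OF \<open>?lift ` f ` S \<in> lmeasurable\<close>]
    by (simp add: drop_lift)
qed

text \<open>Every point of \<open>T \<inter> X\<close> is the image under \<open>a\<close> of a
  point of \<open>W\<close>, so \<open>T \<inter> X\<close> lies in the image of the preimage of
  \<open>X\<close>, whose measure the preceding lemma bounds. Thus Lebesgue measure on
  \<open>T\<close> is at most \<open>B\<close> times the push-forward along \<open>a\<close>; points
  with several preimages only enlarge the push-forward.\<close>

lemma nn_integral_image_le:
  fixes a a' :: "real \<Rightarrow> real" and F :: "real \<Rightarrow> ennreal"
  assumes W: "open W" "bounded W" and B: "0 \<le> B"
    and der: "\<And>x. x \<in> W \<Longrightarrow> (a has_real_derivative a' x) (at x)"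
    and bound: "\<And>x. x \<in> W \<Longrightarrow> \<bar>a' x\<bar> \<le> B"
    and F: "F \<in> borel_measurable borel" and T: "T \<in> sets borel" "T \<subseteq> a ` W"
  shows "(\<integral>\<^sup>+\<theta>\<in>T. F \<theta> \<partial>lborel) \<le> ennreal B * (\<integral>\<^sup>+\<alpha>\<in>W. F (a \<alpha>) \<partial>lborel)"
proof -
  have [measurable]: "W \<in> sets borel" "T \<in> sets borel" "F \<in> borel_measurable borel"
    using W F T by auto
  have "continuous_on W a"
    using der by (meson DERIV_isCont continuous_at_imp_continuous_on)
  then have a: "a \<in> borel_measurable (restrict_space lborel W)"
    using borel_measurable_continuous_on_restrict[of W a]
    by (simp cong: measurable_cong_sets sets_restrict_space_cong)
  \<comment> \<open>Restriction to \<open>T\<close> is expressed by a density, so that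
    \<open>M\<close> and \<open>N\<close> share the Borel sets of the whole line and can be compared
    set by set.\<close>
  define M where "M = density lborel (indicator T)"
  define N where "N = scale_measure (ennreal B) (distr (restrict_space lborel W) borel a)"
  have sets: "sets M = sets N"
    by (simp add: M_def N_def)
  have "M \<le> N"
    unfolding le_measure[OF sets]
  proof
    fix X assume "X \<in> sets M"
    then have X[measurable]: "X \<in> sets borel" by (simp add: M_def)
    define A where "A = a -` X \<inter> W"
    have A: "A \<in> sets borel"
      using measurable_sets[OF a, of X] X
      by (simp add: A_def space_restrict_space sets_restrict_space_iff)
    \<comment> \<open>Boundedness of \<open>W\<close> gives the preimage finite measure, as
      \<open>lmeasurable_bounded_derivative_image\<close> requires.\<close>
    have "bounded A" using W(2) by (rule bounded_subset) (auto simp: A_def)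
    then have Am: "A \<in> lmeasurable"
      using A by (intro bounded_set_imp_lmeasurable) auto
    have im: "a ` A \<in> lmeasurable" "measure lebesgue (a ` A) \<le> B * measure lebesgue A"
      using lmeasurable_bounded_derivative_image[OF Am, of a a' B] der bound
      by (auto simp: A_def intro: DERIV_subset)
    have "emeasure M X = emeasure lborel (T \<inter> X)"
      unfolding M_def by (subst emeasure_restricted) auto
    also have "\<dots> = emeasure lebesgue (T \<inter> X)"
      by simp
    also have "\<dots> \<le> emeasure lebesgue (a ` A)"
      using T im(1) by (intro emeasure_mono) (auto simp: A_def)
    also have "\<dots> = ennreal (measure lebesgue (a ` A))"
      using im(1) by (simp add: emeasure_eq_measure2)
    also have "\<dots> \<le> ennreal (B * measure lebesgue A)"
      using im(2) by (rule ennreal_leI)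
    also have "\<dots> = ennreal B * emeasure lebesgue A"
      using Am B by (simp add: emeasure_eq_measure2 ennreal_mult)
    also have "\<dots> = emeasure N X"
      using a A by (simp add: N_def emeasure_distr emeasure_restrict_space A_def space_restrict_space)
    finally show "emeasure M X \<le> emeasure N X" .
  qed
  then have "nn_integral M F \<le> nn_integral N F"
    using sets by (intro nn_integral_mono_measure)
  moreover have "nn_integral M F = (\<integral>\<^sup>+\<theta>\<in>T. F \<theta> \<partial>lborel)"
    unfolding M_def by (subst nn_integral_density) (auto simp: mult.commute)
  moreover have "nn_integral N F = ennreal B * (\<integral>\<^sup>+\<alpha>\<in>W. F (a \<alpha>) \<partial>lborel)"
    unfolding N_def using a
    by (simp add: nn_integral_scale_measure nn_integral_distr nn_integral_restrict_space)
  ultimately show ?thesis by simp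
qed

lemma borel_measurable_emeasure_image:
  fixes f :: "real \<Rightarrow> 'a::euclidean_space \<Rightarrow> real"
  assumes E: "compact E" and f: "continuous_on UNIV (\<lambda>(x, \<theta>). f \<theta> x)"
  shows "(\<lambda>\<theta>. emeasure lborel (f \<theta> ` E)) \<in> borel_measurable borel"
proof -
  define G where "G = {z. \<exists>x. x \<in> E \<and> (x, z) \<in> {(x, \<theta>, t). f \<theta> x = t}}"
  have "continuous_on UNIV (\<lambda>p::'a \<times> real \<times> real. f (fst (snd p)) (fst p))"
    using continuous_on_compose2[OF f, of UNIV "\<lambda>p::'a \<times> real \<times> real. (fst p, fst (snd p))"]
    by (simp add: continuous_on_fst continuous_on_snd continuous_on_Pair)
  then have "closed {p::'a \<times> real \<times> real. f (fst (snd p)) (fst p) = snd (snd p)}"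
    by (intro closed_Collect_eq continuous_intros) 
  also have "{p::'a \<times> real \<times> real. f (fst (snd p)) (fst p) = snd (snd p)} = {(x, \<theta>, t). f \<theta> x = t}"
    by auto
  finally have "closed G"
    unfolding G_def using E by (intro closed_compact_projection)
  moreover have "sets (borel \<Otimes>\<^sub>M lborel) = sets (borel :: (real \<times> real) measure)"
    by (metis borel_prod sets_lborel sets_pair_measure_cong)
  ultimately have "G \<in> sets (borel \<Otimes>\<^sub>M lborel)"
    by simp
  from lborel.measurable_emeasure_Pair[OF this]
  have "(\<lambda>\<theta>. emeasure lborel (Pair \<theta> -` G)) \<in> borel_measurable borel" .
  moreover have "Pair \<theta> -` G = f \<theta> ` E" for \<theta>
    by (auto simp: G_def)
  ultimately show ?thesis by simp
qed

section \<open>Geometry of squares in arbitrary orientation\<close>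

lemma is_square_props:
  assumes "is_square s Q"
  shows is_square_pos: "0 < s" and is_square_convex: "convex Q" and is_square_compact: "compact Q"
    and is_square_diameter: "\<And>x y. x \<in> Q \<Longrightarrow> y \<in> Q \<Longrightarrow> norm (x - y) \<le> 2 * s"
    and is_square_chord: "\<And>e. norm e = 1 \<Longrightarrow> \<exists>x\<in>Q. x + s *\<^sub>R e \<in> Q"
proof -
  obtain a :: "real^2" and f :: "real^2 \<Rightarrow> real^2" where s: "0 < s" and f: "orthogonal_transformation f"
    and Q: "Q = (\<lambda>x. a + f x) ` cbox 0 (\<chi> i. s)"
    using assms unfolding is_square_def by blast
  have lin: "linear f" using f by (rule orthogonal_transformation_linear)
  have norm_f: "norm (f v) = norm v" for v
    using f by (simp add: orthogonal_transformation)
  have Q': "Q = (+) a ` f ` cbox 0 (\<chi> i. s)" by (simp add: Q image_image)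
  show "0 < s" by (rule s)
  show "convex Q"
    unfolding Q' by (intro convex_translation convex_linear_image lin convex_box)
  show "compact Q"
    unfolding Q' 
    by (intro compact_translation compact_continuous_image linear_continuous_on
        linear_conv_bounded_linear[THEN iffD1] lin compact_cbox)
  show "norm (x - y) \<le> 2 * s" if xy: "x \<in> Q" "y \<in> Q" for x y
  proof -
    obtain u v where uv: "x = a + f u" "y = a + f v" "u \<in> cbox 0 (\<chi> i. s)" "v \<in> cbox 0 (\<chi> i. s)"
      using xy by (auto simp: Q)
    have "norm (x - y) = norm (u - v)"
      using norm_f[of "u - v"] by (simp add: uv linear_diff[OF lin])
    \<comment> \<open>The l1 norm gives the cruder diameter 2s instead of sqrt 2 times s and avoids
      square roots in all later constants.\<close>
    also have "\<dots> \<le> (\<Sum>i\<in>UNIV. \<bar>(u - v) $ i\<bar>)" by (rule norm_le_l1_cart)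
    also have "\<dots> \<le> (\<Sum>i\<in>(UNIV::2 set). s)"
      using uv(3,4) by (intro sum_mono) (auto simp: mem_box_cart abs_le_iff, smt+)
    finally show ?thesis by simp
  qed
  show "\<exists>x\<in>Q. x + s *\<^sub>R e \<in> Q" if e: "norm e = 1" for e
  proof -
    obtain v where v: "e = f v"
      using orthogonal_transformation_surj[OF f] by (metis surjD)
    have "\<bar>v $ i\<bar> \<le> 1" for i
      using component_le_norm_cart[of v i] e v norm_f[of v] by simp
    then have sv: "\<bar>s * v $ i\<bar> \<le> s" for i
      using s by (simp add: abs_mult)
    \<comment> \<open>In the coordinates of the square, the chord is centred at the midpoint: it
      runs from the centre minus (s/2)v to the centre plus (s/2)v. It stays inside since each
      coordinate of v is at most 1 in absolute value.\<close>
    define w :: "real^2" where "w = (\<chi> i. s / 2 - s * v $ i / 2)"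
    have "w \<in> cbox 0 (\<chi> i. s)" "w + s *\<^sub>R v \<in> cbox 0 (\<chi> i. s)"
      using sv by (auto simp: w_def mem_box_cart abs_le_iff field_simps; smt)+
    moreover have "a + f w + s *\<^sub>R e = a + f (w + s *\<^sub>R v)"
      by (simp add: v linear_add[OF lin] linear_scale[OF lin])
    ultimately show ?thesis
      unfolding Q by (metis (no_types, lifting) imageI)
  qed
qed

section \<open>Linearisation on a square, and the estimate for one parameter\<close>

lemma has_derivative_grad:
  assumes "f differentiable (at x)"
  shows "(f has_derivative (\<lambda>v. grad f x \<bullet> v)) (at x)"
proof -
  let ?D = "frechet_derivative f (at x)"
  have D: "(f has_derivative ?D) (at x)"
    using assms by (simp add: frechet_derivative_works)
  then have "linear ?D" by (simp add: has_derivative_linear)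
  then have "?D v = grad f x \<bullet> v" for v
  proof -
    have "?D v = ?D (\<Sum>i\<in>UNIV. (v $ i) *\<^sub>R axis i 1)"
      using basis_expansion[of v] by (simp add: scalar_mult_eq_scaleR)
    also have "\<dots> = (\<Sum>i\<in>UNIV. v $ i * ?D (axis i 1))"
      using \<open>linear ?D\<close> by (simp add: linear_sum linear_scale)
    also have "\<dots> = grad f x \<bullet> v"
      by (simp add: grad_def partial_def inner_vec_def mult.commute)
    finally show ?thesis .
  qed
  then show ?thesis using D by (metis (no_types, lifting) ext)
qed

text \<open>Each partial derivative has gradient of norm at most 2C, so it varies by at most 2Cr
  from its value at z; adding two components, the gradient varies by at most 4Cr. The mean value
  inequality applies this to f minus its linearisation. Keeping z apart from x makes the error
  proportional to the distance of x and y, which is much smaller than r on the small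
  squares.\<close>

lemma taylor_bound:
  fixes f :: "real^2 \<Rightarrow> real"
  assumes Q: "convex Q" and C: "0 \<le> C"
    and f: "\<And>x. x \<in> Q \<Longrightarrow> f differentiable (at x)"
    and pf: "\<And>x j. x \<in> Q \<Longrightarrow> partial j f differentiable (at x)"
    and bound: "\<And>x i j. x \<in> Q \<Longrightarrow> \<bar>partial i (partial j f) x\<bar> \<le> C"
    and r: "\<And>x. x \<in> Q \<Longrightarrow> norm (x - z) \<le> r"
    and z: "z \<in> Q" and xy: "x \<in> Q" "y \<in> Q"
  shows "\<bar>f y - f x - grad f z \<bullet> (y - x)\<bar> \<le> 4 * C * r * norm (y - x)"
proof -
  have grad2: "norm (grad (partial j f) w) \<le> 2 * C" if "w \<in> Q" for w j
  proof -
    have "norm (grad (partial j f) w) \<le> (\<Sum>i\<in>UNIV. \<bar>grad (partial j f) w $ i\<bar>)"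
      by (rule norm_le_l1_cart)
    also have "\<dots> \<le> (\<Sum>i\<in>(UNIV::2 set). C)"
      using bound[OF that] by (intro sum_mono) (simp add: grad_def)
    finally show ?thesis by simp
  qed
  have inner_onorm: "onorm (\<lambda>v. u \<bullet> v) \<le> norm u" for u :: "real^2"
    by (rule onorm_le) (simp add: Cauchy_Schwarz_ineq2)
  have lip: "norm (grad f w - grad f z) \<le> 4 * C * r" if w: "w \<in> Q" for w
  proof -
    have "\<bar>partial j f w - partial j f z\<bar> \<le> 2 * C * r" for j
    proof -
      have "norm (partial j f w - partial j f z) \<le> 2 * C * norm (w - z)"
      proof (rule differentiable_bound[OF Q _ _ w z])
        show "(partial j f has_derivative (\<lambda>v. grad (partial j f) u \<bullet> v)) (at u within Q)"
          if "u \<in> Q" for u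
          using has_derivative_grad[OF pf[OF that]] by (rule has_derivative_at_withinI)
        show "onorm (\<lambda>v. grad (partial j f) u \<bullet> v) \<le> 2 * C" if "u \<in> Q" for u
          using inner_onorm grad2[OF that] order_trans by blast
      qed
      also have "\<dots> \<le> 2 * C * r"
        using r[OF w] C by (intro mult_left_mono) auto
      finally show ?thesis by simp
    qed
    then have "(\<Sum>j\<in>UNIV. \<bar>(grad f w - grad f z) $ j\<bar>) \<le> (\<Sum>j\<in>(UNIV::2 set). 2 * C * r)"
      by (intro sum_mono) (simp add: grad_def)
    with norm_le_l1_cart[of "grad f w - grad f z"] show ?thesis by simp
  qed
  have "norm (f y - f x - grad f z \<bullet> (y - x)) \<le> norm (y - x) * (4 * C * r)"
  proof (rule differentiable_bound_linearization[where S = Q and f' = "\<lambda>w v. grad f w \<bullet> v"])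
    show "x + t *\<^sub>R (y - x) \<in> Q" if "t \<in> {0..1}" for t
      using convexD_alt[OF Q xy, of t] that by (simp add: algebra_simps)
    show "(f has_derivative (\<bullet>) (grad f w)) (at w within Q)" if "w \<in> Q" for w
      using has_derivative_grad[OF f[OF that]] by (rule has_derivative_at_withinI)
    show "onorm ((\<bullet>) (grad f w) - (\<bullet>) (grad f z)) \<le> 4 * C * r" if "w \<in> Q" for w
    proof -
      have "(\<bullet>) (grad f w) - (\<bullet>) (grad f z) = (\<lambda>v. (grad f w - grad f z) \<bullet> v)"
        by (auto simp: inner_diff_left)
      then show ?thesis using inner_onorm lip[OF that] order_trans by metis
    qed
  qed (rule z)
  then show ?thesis by (simp add: mult.commute)
qed

lemma emeasure_image_coarse_le:
  fixes p q :: "'a \<Rightarrow> real" and L :: real and n :: nat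
  assumes L: "0 < L" and meas: "q ` (\<Union>\<S>) \<in> sets lebesgue"
    and near: "\<And>S. S \<in> \<S> \<Longrightarrow> \<exists>u. {u..u + L} \<subseteq> q ` S \<and> (\<forall>x\<in>S. \<bar>p x - u\<bar> \<le> n * L)"
  shows "emeasure lebesgue (p ` (\<Union>\<S>)) \<le> ennreal (2 * n + 1) * emeasure lebesgue (q ` (\<Union>\<S>))"
proof -
  let ?K = "{- int n..int n}"
  \<comment> \<open>The trivial factor \<open>1 *\<^sub>R\<close> gives the translation the form
    needed by \<open>emeasure_lebesgue_affine\<close> below.\<close>
  define A where "A k = (\<lambda>t. 1 *\<^sub>R t + of_int k * L) ` q ` (\<Union>\<S>)" for k :: int
  have A_sets: "A k \<in> sets lebesgue" for k
    using lebesgue_sets_translation[OF meas, of "of_int k * L"] by (simp add: A_def add.commute)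
  have "p ` (\<Union>\<S>) \<subseteq> (\<Union>k\<in>?K. A k)"
  proof
    fix v assume "v \<in> p ` (\<Union>\<S>)"
    then obtain S x where S: "S \<in> \<S>" "x \<in> S" "v = p x" by auto
    then obtain u where u: "{u..u + L} \<subseteq> q ` S" "\<bar>v - u\<bar> \<le> n * L"
      using near by blast
    define k where "k = \<lfloor>(v - u) / L\<rfloor>"
    have k: "of_int k * L \<le> v - u" "v - u < (of_int k + 1) * L"
      using L by (simp_all add: k_def flip: pos_le_divide_eq pos_divide_less_eq)
    have "- real n \<le> (v - u) / L" "(v - u) / L \<le> real n"
      using u(2) L by (simp_all add: field_simps abs_le_iff)
    then have "k \<in> ?K"
      by (simp add: k_def le_floor_iff floor_le_iff)
    moreover have "v - of_int k * L \<in> q ` S"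
      using u(1) k by (auto simp: algebra_simps)
    then have "v \<in> A k"
      unfolding A_def using S(1) by (intro image_eqI[of _ _ "v - of_int k * L"]) auto
    ultimately show "v \<in> (\<Union>k\<in>?K. A k)" by blast
  qed
  then have "emeasure lebesgue (p ` (\<Union>\<S>)) \<le> emeasure lebesgue (\<Union>k\<in>?K. A k)"
    using A_sets by (intro emeasure_mono) auto
  also have "\<dots> \<le> (\<Sum>k\<in>?K. emeasure lebesgue (A k))"
    using A_sets by (intro emeasure_subadditive_finite) auto
  also have "\<dots> = (\<Sum>k\<in>?K. emeasure lebesgue (q ` (\<Union>\<S>)))"
    unfolding A_def emeasure_lebesgue_affine by simp
  also have "\<dots> = ennreal (2 * n + 1) * emeasure lebesgue (q ` (\<Union>\<S>))"
    by (simp add: ennreal_of_nat_eq_real_of_nat nat_add_distrib)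
  finally show ?thesis .
qed

text \<open>A chord of \<open>S\<close> of length \<open>\<delta>\<^sup>2\<close> in the direction
  of the gradient at z makes the linear part grow by at least \<open>\<delta>\<^sup>2 / C\<close>.
  The Taylor error consumes at most half of this, and connectedness of \<open>S\<close> fills the
  interval between the two end values. The starting value of \<open>f\<close> on the chord serves as
  u.\<close>

lemma square_image_interval:
  fixes f :: "real^2 \<Rightarrow> real"
  assumes C: "1 \<le> C" and Q: "is_square \<delta> Q" and S: "is_square (\<delta>\<^sup>2) S" "S \<subseteq> Q" and z: "z \<in> Q"
    and \<delta>: "\<delta> < 1 / (16 * C\<^sup>2)"
    and f: "\<And>x. x \<in> Q \<Longrightarrow> f differentiable (at x)"
    and pf: "\<And>x j. x \<in> Q \<Longrightarrow> partial j f differentiable (at x)"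
    and bound: "\<And>x i j. x \<in> Q \<Longrightarrow> \<bar>partial i (partial j f) x\<bar> \<le> C"
    and grad: "inverse C \<le> norm (grad f z)" "norm (grad f z) \<le> C"
  shows "\<exists>u. {u..u + \<delta>\<^sup>2 / (2 * C)} \<subseteq> f ` S \<and>
    (\<forall>x\<in>S. \<bar>grad f z \<bullet> x + (f z - grad f z \<bullet> z) - u\<bar> \<le> nat \<lceil>36 * C\<^sup>2\<rceil> * (\<delta>\<^sup>2 / (2 * C)))"
proof -
  let ?g = "grad f z"
  have \<delta>0: "0 < \<delta>" using Q by (rule is_square_pos)
  have taylor: "\<bar>f y - f x - ?g \<bullet> (y - x)\<bar> \<le> 8 * C * \<delta> * norm (y - x)" if "x \<in> Q" "y \<in> Q" for x y
    using taylor_bound[OF is_square_convex[OF Q] _ f pf bound is_square_diameter[OF Q _ z] z that] C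
    by simp
  have g0: "norm ?g > 0"
    using grad(1) C by (meson inverse_positive_iff_positive less_le_trans zero_less_one)
  define e where "e = ?g /\<^sub>R norm ?g"
  have e: "norm e = 1" "?g \<bullet> e = norm ?g"
    using g0 by (auto simp: e_def dot_square_norm power2_eq_square)
  obtain x where x: "x \<in> S" "x + \<delta>\<^sup>2 *\<^sub>R e \<in> S"
    using is_square_chord[OF S(1) e(1)] by blast
  have "\<bar>f (x + \<delta>\<^sup>2 *\<^sub>R e) - f x - \<delta>\<^sup>2 * norm ?g\<bar> \<le> 8 * C * \<delta> * \<delta>\<^sup>2"
    using taylor[of x "x + \<delta>\<^sup>2 *\<^sub>R e"] x S(2) e by auto
  \<comment> \<open>The bound on \<delta> is chosen for this line: it says that 8C\<delta> is below
    1/(2C).\<close>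
  moreover have "8 * C * \<delta> * \<delta>\<^sup>2 \<le> inverse (2 * C) * \<delta>\<^sup>2"
    using \<delta> C by (intro mult_right_mono) (auto simp: field_simps power2_eq_square)
  moreover have "inverse C * \<delta>\<^sup>2 \<le> norm ?g * \<delta>\<^sup>2"
    using grad(1) by (intro mult_right_mono) auto
  moreover have "inverse C * \<delta>\<^sup>2 = 2 * (\<delta>\<^sup>2 / (2 * C))" "inverse (2 * C) * \<delta>\<^sup>2 = \<delta>\<^sup>2 / (2 * C)"
    by (simp_all add: field_simps)
  ultimately have "f x + \<delta>\<^sup>2 / (2 * C) \<le> f (x + \<delta>\<^sup>2 *\<^sub>R e)"
    unfolding mult.commute[of "\<delta>\<^sup>2" "norm ?g"] by linarith
  moreover have "connected (f ` S)"
    using f S(2) is_square_convex[OF S(1)]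
    by (intro connected_continuous_image convex_connected continuous_at_imp_continuous_on)
       (auto intro: differentiable_imp_continuous_within)
  then have "{f x..f (x + \<delta>\<^sup>2 *\<^sub>R e)} \<subseteq> f ` S"
    using x by (intro connected_contains_Icc) auto
  ultimately have "{f x..f x + \<delta>\<^sup>2 / (2 * C)} \<subseteq> f ` S"
    by (auto simp: subset_iff)
  \<comment> \<open>The difference is \<open>?g \<bullet> (y - x)\<close> minus the Taylor error
    from z to x. The former is at most \<open>2 * C * \<delta>\<^sup>2\<close> because
    \<open>S\<close> is small, the latter at most \<open>16 * C * \<delta>\<^sup>2\<close> because
    \<open>Q\<close> has side \<delta>; the sum is 36 C^2 times the interval length.\<close>
  moreover have "\<bar>?g \<bullet> y + (f z - ?g \<bullet> z) - f x\<bar> \<le> nat \<lceil>36 * C\<^sup>2\<rceil> * (\<delta>\<^sup>2 / (2 * C))"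
    if y: "y \<in> S" for y
  proof -
    have "\<bar>?g \<bullet> (y - x)\<bar> \<le> norm ?g * norm (y - x)"
      by (rule Cauchy_Schwarz_ineq2)
    also have "\<dots> \<le> C * (2 * \<delta>\<^sup>2)"
      using is_square_diameter[OF S(1) y x(1)] grad(2) C by (intro mult_mono) auto
    finally have 1: "\<bar>?g \<bullet> (y - x)\<bar> \<le> C * (2 * \<delta>\<^sup>2)" .
    have "\<bar>f x - f z - ?g \<bullet> (x - z)\<bar> \<le> 8 * C * \<delta> * norm (x - z)"
      using taylor[OF z, of x] x S(2) by auto
    also have "\<dots> \<le> 8 * C * \<delta> * (2 * \<delta>)"
      using is_square_diameter[OF Q _ z, of x] x S(2) C \<delta>0 by (intro mult_left_mono) auto
    finally have 2: "\<bar>f x - f z - ?g \<bullet> (x - z)\<bar> \<le> 16 * C * \<delta>\<^sup>2"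
      by (simp add: power2_eq_square)
    have "\<bar>?g \<bullet> y + (f z - ?g \<bullet> z) - f x\<bar> \<le> 18 * C * \<delta>\<^sup>2"
      using 1 2 by (simp add: inner_diff_right)
    also have "\<dots> = 36 * C\<^sup>2 * (\<delta>\<^sup>2 / (2 * C))"
      using C by (simp add: power2_eq_square)
    also have "\<dots> \<le> nat \<lceil>36 * C\<^sup>2\<rceil> * (\<delta>\<^sup>2 / (2 * C))"
      using C by (intro mult_right_mono real_nat_ceiling_ge) auto
    finally show ?thesis .
  qed
  ultimately show ?thesis by blast
qed

text \<open>Since \<theta> is an angle of the gradient g at z, the linearisation at z is |g| times
  \<open>proj \<theta>\<close> plus a constant, so its image of the union has |g| times the measure
  of the projection. The coarse comparison bounds that image by the image of \<open>f\<close>, and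
  |g| being at least 1/C accounts for the factor C.\<close>

lemma emeasure_proj_le:
  fixes f :: "real^2 \<Rightarrow> real"
  assumes C: "1 \<le> C" and Q: "is_square \<delta> Q" and \<S>: "finite \<S>" "\<And>S. S \<in> \<S> \<Longrightarrow> is_square (\<delta>\<^sup>2) S"
    and sub: "\<Union>\<S> \<subseteq> Q" and z: "z \<in> Q"
    and \<delta>: "\<delta> < 1 / (16 * C\<^sup>2)"
    and f: "\<And>x. x \<in> Q \<Longrightarrow> f differentiable (at x)"
    and pf: "\<And>x j. x \<in> Q \<Longrightarrow> partial j f differentiable (at x)"
    and bound: "\<And>x i j. x \<in> Q \<Longrightarrow> \<bar>partial i (partial j f) x\<bar> \<le> C"
    and grad: "inverse C \<le> norm (grad f z)" "norm (grad f z) \<le> C"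
    and \<theta>: "vector [cos \<theta>, sin \<theta>] = grad f z /\<^sub>R norm (grad f z)"
  shows "emeasure lebesgue (proj \<theta> ` (\<Union>\<S>))
     \<le> ennreal (C * (2 * nat \<lceil>36 * C\<^sup>2\<rceil> + 1)) * emeasure lebesgue (f ` (\<Union>\<S>))"
proof -
  let ?g = "grad f z" and ?E = "\<Union>\<S>"
  let ?c = "f z - ?g \<bullet> z" and ?n = "nat \<lceil>36 * C\<^sup>2\<rceil>"
  have "compact ?E"
    using \<S> is_square_compact by (intro compact_Union) auto
  moreover have "continuous_on ?E f"
    using f sub by (intro continuous_at_imp_continuous_on) (auto intro: differentiable_imp_continuous_within)
  ultimately have meas: "f ` ?E \<in> sets lebesgue"
    by (intro sets_completionI_sets) (auto intro: borel_compact compact_continuous_image)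
  have g0: "norm ?g > 0"
    using grad(1) C by (meson inverse_positive_iff_positive less_le_trans zero_less_one)
  have "?g = norm ?g *\<^sub>R vector [cos \<theta>, sin \<theta>]"
    using g0 by (simp add: \<theta>)
  then have "?g $ 1 = norm ?g * cos \<theta>" "?g $ 2 = norm ?g * sin \<theta>"
    by (metis vector_scaleR_component real_scaleR_def vector_2)+
  then have "?g \<bullet> x = norm ?g * proj \<theta> x" for x
    by (simp add: inner_vec_def sum_2 proj_def algebra_simps)
  then have img: "(\<lambda>x. ?g \<bullet> x + ?c) ` ?E = (\<lambda>t. norm ?g *\<^sub>R t + ?c) ` proj \<theta> ` ?E"
    by (simp add: image_image)
  have "1 \<le> C * norm ?g"
    using mult_left_mono[OF grad(1), of C] C by simp
  then have "emeasure lebesgue (proj \<theta> ` ?E) \<le> ennreal (C * norm ?g) * emeasure lebesgue (proj \<theta> ` ?E)"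
    using mult_right_mono[of 1 "ennreal (C * norm ?g)" "emeasure lebesgue (proj \<theta> ` ?E)"]
    by simp
  also have "\<dots> = ennreal C * emeasure lebesgue ((\<lambda>x. ?g \<bullet> x + ?c) ` ?E)"
    unfolding img emeasure_lebesgue_affine using C by (simp add: ennreal_mult mult.assoc)
  also have "\<dots> \<le> ennreal C * (ennreal (2 * ?n + 1) * emeasure lebesgue (f ` ?E))"
  proof (intro mult_left_mono emeasure_image_coarse_le[where L = "\<delta>\<^sup>2 / (2 * C)"])
    show "0 < \<delta>\<^sup>2 / (2 * C)"
      using is_square_pos[OF Q] C by simp
    show "\<exists>u. {u..u + \<delta>\<^sup>2 / (2 * C)} \<subseteq> f ` S \<and>
        (\<forall>x\<in>S. \<bar>?g \<bullet> x + ?c - u\<bar> \<le> ?n * (\<delta>\<^sup>2 / (2 * C)))" if "S \<in> \<S>" for S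
      using sub that
      by (intro square_image_interval[OF C Q \<S>(2)[OF that] _ z \<delta> f pf bound grad]) auto
  qed (use meas in auto)
  also have "\<dots> = ennreal (C * (2 * ?n + 1)) * emeasure lebesgue (f ` ?E)"
    using C by (subst ennreal_mult) (auto simp only: mult.assoc of_nat_0_le_iff)
  finally show ?thesis .
qed

section \<open>Derivatives in the point and the parameter, and the angle of a plane curve\<close>

lemma has_derivative_section:
  fixes P :: "'a::real_normed_vector \<times> 'b::real_normed_vector \<Rightarrow> 'c::real_normed_vector"
  assumes "P differentiable (at (a, x))"
  shows "((\<lambda>y. P (a, y)) has_derivative (\<lambda>v. frechet_derivative P (at (a, x)) (0, v))) (at x)"
    and "((\<lambda>b. P (b, x)) has_derivative (\<lambda>v. frechet_derivative P (at (a, x)) (v, 0))) (at a)"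
proof -
  have P: "(P has_derivative frechet_derivative P (at (a, x))) (at (a, x))"
    using assms by (simp add: frechet_derivative_works)
  show "((\<lambda>y. P (a, y)) has_derivative (\<lambda>v. frechet_derivative P (at (a, x)) (0, v))) (at x)"
    by (rule has_derivative_compose[where g = P and f = "Pair a" and f' = "Pair 0", unfolded o_def])
       (auto intro!: derivative_eq_intros P)
  show "((\<lambda>b. P (b, x)) has_derivative (\<lambda>v. frechet_derivative P (at (a, x)) (v, 0))) (at a)"
    by (rule has_derivative_compose[where g = P and f = "\<lambda>b. (b, x)" and f' = "\<lambda>v. (v, 0)", unfolded o_def])
       (auto intro!: derivative_eq_intros P)
qed

text \<open>On \<open>I \<times> U\<close> the partial derivatives of the slices agree with the
  directional derivative \<open>G\<close> of the joint function, which is again differentiable. As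
  \<open>I\<close> and \<open>U\<close> are open, the slices of \<open>G\<close> in either variable
  transfer their derivatives.\<close>

lemma Ck_on_2_partials:
  fixes \<Phi> :: "real \<Rightarrow> real^2 \<Rightarrow> real"
  assumes \<Phi>: "Ck_on 2 (I \<times> U) (\<lambda>(\<alpha>, x). \<Phi> \<alpha> x)" and I: "open I" and U: "open U"
    and \<alpha>: "\<alpha> \<in> I" and x: "x \<in> U"
  shows "\<Phi> \<alpha> differentiable (at x)"
    and "partial i (\<Phi> \<alpha>) differentiable (at x)"
    and "((\<lambda>a. partial i (\<Phi> a) x) has_real_derivative partial_param i \<Phi> \<alpha> x) (at \<alpha>)"
proof -
  define P where "P = (\<lambda>(\<alpha>, x). \<Phi> \<alpha> x)"
  define G where "G z = frechet_derivative P (at z) (0, axis i 1)" for z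
  have C1: "P differentiable (at z)" and
    C2: "b \<in> Basis \<Longrightarrow> (\<lambda>z. frechet_derivative P (at z) b) differentiable (at z)"
    if "z \<in> I \<times> U" for z b
    using \<Phi> that by (auto simp: P_def numeral_2_eq_2)
  have "(0 :: real, axis i 1 :: real^2) \<in> Basis"
    by (simp add: Basis_prod_def axis_in_Basis_iff)
  then have G: "G differentiable (at z)" if "z \<in> I \<times> U" for z
    using C2[OF that] by (simp add: G_def[abs_def])
  have der: "(\<Phi> a has_derivative (\<lambda>v. frechet_derivative P (at (a, y)) (0, v))) (at y)"
    if "a \<in> I" "y \<in> U" for a y
    using has_derivative_section(1)[OF C1, of a y] that by (simp add: P_def)
  then show "\<Phi> \<alpha> differentiable (at x)"
    using \<alpha> x by (auto simp: differentiable_def)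
  have partial: "partial i (\<Phi> a) y = G (a, y)" if "a \<in> I" "y \<in> U" for a y
    using frechet_derivative_at[OF der[OF that]] by (metis G_def partial_def)
  show "partial i (\<Phi> \<alpha>) differentiable (at x)"
  proof -
    have "(partial i (\<Phi> \<alpha>) has_derivative (\<lambda>v. frechet_derivative G (at (\<alpha>, x)) (0, v))) (at x)"
      by (rule has_derivative_transform_within_open[OF has_derivative_section(1)[OF G] U x])
         (use \<alpha> x partial in auto)
    then show ?thesis by (auto simp: differentiable_def)
  qed
  have "((\<lambda>a. partial i (\<Phi> a) x) has_derivative (\<lambda>v. frechet_derivative G (at (\<alpha>, x)) (v, 0))) (at \<alpha>)"
    by (rule has_derivative_transform_within_open[OF has_derivative_section(2)[OF G] I \<alpha>])
       (use \<alpha> x partial in auto)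
  then have "(\<lambda>a. partial i (\<Phi> a) x) differentiable (at \<alpha>)"
    by (auto simp: differentiable_def)
  then show "((\<lambda>a. partial i (\<Phi> a) x) has_real_derivative partial_param i \<Phi> \<alpha> x) (at \<alpha>)"
    unfolding partial_param_def
    by (metis DERIV_deriv_iff_real_differentiable)
qed

text \<open>Off the cut, the argument of a curve z(t) has derivative Im (z'/z). When p and q are
  minus the components of the gradient and t is the parameter, the numerator is the determinant of
  \<open>jac_matrix\<close>.\<close>

lemma has_real_derivative_Im_Ln:
  fixes p q :: "real \<Rightarrow> real"
  assumes p: "(p has_real_derivative p') (at t)" and q: "(q has_real_derivative q') (at t)"
    and pq: "Complex (p t) (q t) \<notin> \<real>\<^sub>\<le>\<^sub>0"
  shows "((\<lambda>t. Im (Ln (Complex (p t) (q t)))) has_real_derivative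
           (p t * q' - q t * p') / ((p t)\<^sup>2 + (q t)\<^sup>2)) (at t)"
proof -
  have "((\<lambda>t. Complex (p t) (q t)) has_vector_derivative Complex p' q') (at t)"
    using p q by (auto simp: has_vector_derivative_complex_iff has_real_derivative_iff_has_vector_derivative)
  from field_vector_diff_chain_at[OF this has_field_derivative_Ln[OF pq]]
  have "((\<lambda>t. Im (Ln (Complex (p t) (q t)))) has_vector_derivative
          Im (Complex p' q' * inverse (Complex (p t) (q t)))) (at t)"
    using bounded_linear.has_vector_derivative[OF bounded_linear_Im] by (force simp: o_def)
  moreover have "Im (Complex p' q' * inverse (Complex (p t) (q t))) =
      (p t * q' - q t * p') / ((p t)\<^sup>2 + (q t)\<^sup>2)"
    by (simp add: diff_divide_distrib mult.commute)
  ultimately show ?thesis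
    by (simp add: has_real_derivative_iff_has_vector_derivative)
qed

section \<open>Integration over the parameter\<close>

theorem theorem2p3:
  fixes I :: "real set" and U V :: "(real^2) set"
    and \<Phi> :: "real \<Rightarrow> real^2 \<Rightarrow> real" and C\<^sub>0 :: real
  assumes I: "is_interval I" "open I" "bounded I"
    and U: "open U"
    and \<Phi>: "Ck_on 2 (I \<times> U) (\<lambda>(\<alpha>, x). \<Phi> \<alpha> x)"
    and C0: "C\<^sub>0 \<ge> 1"
    and grad_bounds: "\<And>\<alpha> x. \<alpha> \<in> I \<Longrightarrow> x \<in> U \<Longrightarrow>
           inverse C\<^sub>0 \<le> norm (grad (\<Phi> \<alpha>) x) \<and> norm (grad (\<Phi> \<alpha>) x) \<le> C\<^sub>0"
    and second_bounds: "\<And>\<alpha> x i j. \<alpha> \<in> I \<Longrightarrow> x \<in> U \<Longrightarrow>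
           \<bar>partial i (partial j (\<Phi> \<alpha>)) x\<bar> \<le> C\<^sub>0"
    and det_bounds: "\<And>\<alpha> x. \<alpha> \<in> I \<Longrightarrow> x \<in> U \<Longrightarrow>
           inverse C\<^sub>0 \<le> \<bar>det (jac_matrix \<Phi> \<alpha> x)\<bar> \<and> \<bar>det (jac_matrix \<Phi> \<alpha> x)\<bar> \<le> C\<^sub>0"
    and V: "compact V" "V \<subseteq> U"
  shows "\<exists>\<delta>\<^sub>0>0. \<forall>M::nat. \<exists>c::real. c > 0 \<and>
    (\<forall>\<delta> Q \<S> E \<Theta> x\<^sub>0.
       \<delta> < \<delta>\<^sub>0 \<longrightarrow> is_square \<delta> Q \<longrightarrow> Q \<subseteq> V \<longrightarrow>
       finite \<S> \<longrightarrow> (\<forall>S\<in>\<S>. is_square (\<delta>\<^sup>2) S) \<longrightarrow> E = \<Union>\<S> \<longrightarrow> E \<subseteq> Q \<longrightarrow>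
       (\<forall>\<alpha>\<in>I. \<forall>y. finite (components (Q \<inter> \<Phi> \<alpha> -` {y})) \<and>
                  card (components (Q \<inter> \<Phi> \<alpha> -` {y})) \<le> M) \<longrightarrow>
       is_interval \<Theta> \<longrightarrow> \<Theta> \<subseteq> {0..2 * pi} \<longrightarrow> x\<^sub>0 \<in> Q \<longrightarrow>
       (\<forall>\<theta>\<in>\<Theta>. \<exists>\<alpha>\<in>I. is_grad_angle \<Phi> \<alpha> x\<^sub>0 \<theta>) \<longrightarrow>
       Fav I \<Phi> E \<ge> ennreal c * (\<integral>\<^sup>+\<theta>\<in>\<Theta>. emeasure lebesgue (proj \<theta> ` E) \<partial>lebesgue))"
proof -
  note diff = Ck_on_2_partials[OF \<Phi> I(2) U]
  \<comment> \<open>\<open>K\<close> is the loss of \<open>emeasure_proj_le\<close> for a single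
    parameter, and \<open>C\<^sub>0 ^ 3\<close> will bound the speed of the gradient angle;
    \<open>c\<close> is the inverse of the product.\<close>
  define K where "K = C\<^sub>0 * (2 * nat \<lceil>36 * C\<^sub>0\<^sup>2\<rceil> + 1)"
  define c where "c = inverse (C\<^sub>0 ^ 3 * K)"
  have K: "0 < K"
    unfolding K_def using C0 by (intro mult_pos_pos of_nat_0_less_iff[THEN iffD2]) auto
  then have c: "0 < c"
    using C0 by (simp add: c_def)
  have "ennreal c * (\<integral>\<^sup>+\<theta>\<in>\<Theta>. emeasure lebesgue (proj \<theta> ` (\<Union>\<S>)) \<partial>lebesgue) \<le> Fav I \<Phi> (\<Union>\<S>)"
    if \<delta>: "\<delta> < 1 / (16 * C\<^sub>0\<^sup>2)" and Q: "is_square \<delta> Q" "Q \<subseteq> V"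
      and \<S>: "finite \<S>" "\<And>S. S \<in> \<S> \<Longrightarrow> is_square (\<delta>\<^sup>2) S" and E: "\<Union>\<S> \<subseteq> Q"
      and \<Theta>: "is_interval \<Theta>" "\<Theta> \<subseteq> {0..2 * pi}" and z: "z \<in> Q"
      and angle: "\<And>\<theta>. \<theta> \<in> \<Theta> \<Longrightarrow> \<exists>\<alpha>\<in>I. is_grad_angle \<Phi> \<alpha> z \<theta>"
    for \<delta> Q \<S> \<Theta> z
  proof -
    let ?E = "\<Union>\<S>"
    have QU: "x \<in> U" if "x \<in> Q" for x using that Q V by auto
    note zU = QU[OF z]
    \<comment> \<open>\<open>h\<close> is minus the gradient: the cut of \<open>Ln\<close> then puts the branch of \<open>a\<close> at \<open>0\<close> and \<open>2\<pi>\<close>.\<close>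
    define h where "h \<alpha> = Complex (- partial 1 (\<Phi> \<alpha>) z) (- partial 2 (\<Phi> \<alpha>) z)" for \<alpha>
    define W where "W = {\<alpha>\<in>I. h \<alpha> \<notin> \<real>\<^sub>\<le>\<^sub>0}"
    \<comment> \<open>Adding pi undoes the sign in \<open>h\<close>: on \<open>I\<close>,
      \<open>a \<alpha>\<close> is the angle of the gradient in (0, 2 pi], and the value 2 pi occurs
      only off \<open>W\<close>.\<close>
    define a where "a \<alpha> = Im (Ln (h \<alpha>)) + pi" for \<alpha>
    define a' where "a' \<alpha> = det (jac_matrix \<Phi> \<alpha> z) / (norm (grad (\<Phi> \<alpha>) z))\<^sup>2" for \<alpha>
    define F where "F \<theta> = emeasure lborel (proj \<theta> ` ?E)" for \<theta>
    \<comment> \<open>The two end points are a null set; the remaining angles are values of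
      \<open>a\<close> on \<open>W\<close>.\<close>
    define T where "T = \<Theta> \<inter> {0<..<2 * pi}"
    have partials: "partial 1 (\<Phi> \<alpha>) z = - Re (h \<alpha>)" "partial 2 (\<Phi> \<alpha>) z = - Im (h \<alpha>)" for \<alpha>
      by (simp_all add: h_def)
    have grad_norm: "norm (grad (\<Phi> \<alpha>) z) = norm (h \<alpha>)" for \<alpha>
      by (simp add: norm_vec_def L2_set_def sum_2 grad_def h_def cmod_def)
    have h0: "0 < norm (h \<alpha>)" if "\<alpha> \<in> I" for \<alpha>
      using grad_bounds[OF that zU] C0 grad_norm[of \<alpha>]
      by (metis inverse_positive_iff_positive less_le_trans zero_less_one)
    have proj_cont: "continuous_on UNIV (\<lambda>(x, \<theta>). proj \<theta> x)"
      unfolding proj_def case_prod_unfold by (intro continuous_intros)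
    have "compact ?E"
      using \<S> is_square_compact by (intro compact_Union) auto
    then have F: "F \<in> borel_measurable borel"
      unfolding F_def by (intro borel_measurable_emeasure_image proj_cont)
    have "compact (proj \<theta> ` ?E)" for \<theta>
      unfolding proj_def using \<open>compact ?E\<close>
      by (intro compact_continuous_image continuous_intros)
    then have F_eq: "F \<theta> = emeasure lebesgue (proj \<theta> ` ?E)" for \<theta>
      by (simp add: F_def borel_compact)
    have "open W"
    proof -
      have "continuous_on I h"
        unfolding h_def Complex_eq
        using diff(3)[OF _ zU]
        by (intro continuous_intros) (meson DERIV_isCont continuous_at_imp_continuous_on)+
      then have "open (I \<inter> h -` (- \<real>\<^sub>\<le>\<^sub>0))"
        using I(2) by (intro continuous_open_preimage) auto
      also have "I \<inter> h -` (- \<real>\<^sub>\<le>\<^sub>0) = W" by (auto simp: W_def)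
      finally show ?thesis .
    qed
    have "bounded W" using I(3) by (rule bounded_subset) (auto simp: W_def)
    have der: "(a has_real_derivative a' \<alpha>) (at \<alpha>)" if "\<alpha> \<in> W" for \<alpha>
    proof -
      have \<alpha>: "\<alpha> \<in> I" "h \<alpha> \<notin> \<real>\<^sub>\<le>\<^sub>0" using that by (auto simp: W_def)
      have "((\<lambda>\<alpha>. Im (Ln (h \<alpha>))) has_real_derivative a' \<alpha>) (at \<alpha>)"
        using has_real_derivative_Im_Ln[OF DERIV_minus[OF diff(3)[OF \<alpha>(1) zU]]
            DERIV_minus[OF diff(3)[OF \<alpha>(1) zU]], of 1 2] \<alpha>(2)
        by (simp add: h_def a'_def jac_matrix_def det_2 vector_2 grad_norm cmod_power2 mult.commute)
      from DERIV_add[OF this DERIV_const[of pi]] show ?thesis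
        by (simp add: a_def[abs_def])
    qed
    have a'_bound: "\<bar>a' \<alpha>\<bar> \<le> C\<^sub>0 ^ 3" if "\<alpha> \<in> W" for \<alpha>
    proof -
      have \<alpha>: "\<alpha> \<in> I" using that by (auto simp: W_def)
      have "\<bar>det (jac_matrix \<Phi> \<alpha> z)\<bar> \<le> C\<^sub>0"
        using det_bounds[OF \<alpha> zU] by simp
      \<comment> \<open>Splitting off the inverse square prepares for the lower bound on the
        gradient, whose squared norm is the denominator of \<open>a'\<close>.\<close>
      also have "C\<^sub>0 = C\<^sub>0 ^ 3 * (inverse C\<^sub>0)\<^sup>2"
        using C0 by (simp add: field_simps power2_eq_square power3_eq_cube)
      also have "\<dots> \<le> C\<^sub>0 ^ 3 * (norm (grad (\<Phi> \<alpha>) z))\<^sup>2"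
        using grad_bounds[OF \<alpha> zU] C0 by (intro mult_left_mono power_mono) auto
      finally show ?thesis
        using h0[OF \<alpha>] by (simp add: a'_def abs_divide grad_norm divide_le_eq)
    qed
    \<comment> \<open>For \<theta> strictly between 0 and 2 pi, \<theta> - pi lies in the range of
      the principal argument, so it is the argument of \<open>h \<alpha>\<close> for the parameter
      given by (b). On the cut this argument would be pi, forcing \<theta> = 2 pi.\<close>
    have TW: "T \<subseteq> a ` W"
    proof
      fix \<theta> assume "\<theta> \<in> T"
      then have \<theta>: "\<theta> \<in> \<Theta>" "0 < \<theta>" "\<theta> < 2 * pi" by (auto simp: T_def)
      then obtain \<alpha> where \<alpha>: "\<alpha> \<in> I" "is_grad_angle \<Phi> \<alpha> z \<theta>" using angle by blast
      then have "norm (h \<alpha>) *\<^sub>R (vector [cos \<theta>, sin \<theta>] :: real^2) = grad (\<Phi> \<alpha>) z"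
        using h0[OF \<alpha>(1)] by (simp add: is_grad_angle_def grad_norm)
      then have "norm (h \<alpha>) * cos \<theta> = - Re (h \<alpha>)" "norm (h \<alpha>) * sin \<theta> = - Im (h \<alpha>)"
        by (auto simp: vec_eq_iff forall_2 vector_2 grad_def partials)
      then have "exp (Complex (ln (norm (h \<alpha>))) (\<theta> - pi)) = h \<alpha>"
        using h0[OF \<alpha>(1)] by (intro complex_eqI) (simp_all add: Re_exp Im_exp cos_diff sin_diff)
      then have "Ln (h \<alpha>) = Complex (ln (norm (h \<alpha>))) (\<theta> - pi)"
        using \<theta> by (intro Ln_unique) auto
      then have "Im (Ln (h \<alpha>)) = \<theta> - pi" by simp
      moreover from this have "h \<alpha> \<notin> \<real>\<^sub>\<le>\<^sub>0"
        using \<theta> h0[OF \<alpha>(1)] Im_Ln_eq_pi[of "h \<alpha>"]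
        by (auto simp: complex_nonpos_Reals_iff less_le complex_eq_iff)
      ultimately show "\<theta> \<in> a ` W"
        using \<alpha>(1) by (intro image_eqI[of _ _ \<alpha>]) (auto simp: a_def W_def)
    qed
    have a_angle: "is_grad_angle \<Phi> \<alpha> z (a \<alpha>)" if "\<alpha> \<in> I" for \<alpha>
    proof -
      have "h \<alpha> = exp (Ln (h \<alpha>))" using h0[OF that] by simp
      moreover have "exp (Re (Ln (h \<alpha>))) = norm (h \<alpha>)" using h0[OF that] by simp
      ultimately have "Re (h \<alpha>) = norm (h \<alpha>) * cos (Im (Ln (h \<alpha>)))"
        "Im (h \<alpha>) = norm (h \<alpha>) * sin (Im (Ln (h \<alpha>)))"
        by (metis Re_exp, metis Im_exp)
      then have "norm (h \<alpha>) * cos (a \<alpha>) = - Re (h \<alpha>)" "norm (h \<alpha>) * sin (a \<alpha>) = - Im (h \<alpha>)"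
        by (simp_all add: a_def)
      then show ?thesis
        using h0[OF that] unfolding is_grad_angle_def grad_norm
        by (simp add: vec_eq_iff forall_2 vector_2 grad_def partials field_simps)
    qed
    have FG: "F (a \<alpha>) \<le> ennreal K * emeasure lebesgue (\<Phi> \<alpha> ` ?E)" if "\<alpha> \<in> I" for \<alpha>
      unfolding F_eq K_def
      using grad_bounds[OF that zU] second_bounds[OF that QU] diff(1,2)[OF that QU]
        a_angle[OF that, unfolded is_grad_angle_def]
      by (intro emeasure_proj_le[OF C0 Q(1) \<S> E z \<delta>]) auto
    have "(\<integral>\<^sup>+\<theta>\<in>\<Theta>. emeasure lebesgue (proj \<theta> ` ?E) \<partial>lebesgue) = (\<integral>\<^sup>+\<theta>\<in>\<Theta>. F \<theta> \<partial>lborel)"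
      by (simp add: F_eq nn_integral_completion)
    also have "\<dots> = (\<integral>\<^sup>+\<theta>\<in>T. F \<theta> \<partial>lborel)"
    proof (rule nn_integral_cong_AE)
      have "AE \<theta> in lborel. \<theta> \<noteq> (0 :: real)" "AE \<theta> in lborel. \<theta> \<noteq> 2 * pi"
        by (rule AE_lborel_singleton)+
      then show "AE \<theta> in lborel. F \<theta> * indicator \<Theta> \<theta> = F \<theta> * indicator T \<theta>"
        by eventually_elim (use \<Theta>(2) in \<open>auto simp: T_def indicator_def\<close>)
    qed
    also have "\<dots> \<le> ennreal (C\<^sub>0 ^ 3) * (\<integral>\<^sup>+\<alpha>\<in>W. F (a \<alpha>) \<partial>lborel)"
    proof (rule nn_integral_image_le[OF \<open>open W\<close> \<open>bounded W\<close> _ der a'_bound F _ TW])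
      show "T \<in> sets borel"
        using \<Theta>(1) by (auto simp: T_def intro: sets.Int real_interval_borel_measurable)
    qed (use C0 in auto)
    finally have "ennreal c * (\<integral>\<^sup>+\<theta>\<in>\<Theta>. emeasure lebesgue (proj \<theta> ` ?E) \<partial>lebesgue)
        \<le> ennreal c * (ennreal (C\<^sub>0 ^ 3) * (\<integral>\<^sup>+\<alpha>\<in>W. F (a \<alpha>) \<partial>lborel))"
      by (rule mult_left_mono) simp
    also have "\<dots> = ennreal (inverse K) * (\<integral>\<^sup>+\<alpha>\<in>W. F (a \<alpha>) \<partial>lborel)"
    proof -
      have "c * C\<^sub>0 ^ 3 = inverse K"
        using C0 by (simp add: c_def)
      then have "ennreal c * ennreal (C\<^sub>0 ^ 3) = ennreal (inverse K)"
        using c C0 by (metis ennreal_mult less_imp_le zero_le_power zero_less_one order_less_le_trans)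
      then show ?thesis by (simp only: mult.assoc[symmetric])
    qed
    \<comment> \<open>The constant is moved inside while the integrand is still the measurable
      \<open>F (a \<alpha>)\<close>. The remaining steps are monotonicity and
      \<open>nn_integral_completion\<close>, both valid for arbitrary integrands, so measurability
      of the integrand of \<open>Fav\<close> does not come up.\<close>
    also have "\<dots> = (\<integral>\<^sup>+\<alpha>. ennreal (inverse K) * (F (a \<alpha>) * indicator W \<alpha>) \<partial>lborel)"
    proof (rule nn_integral_cmult[symmetric])
      have "continuous_on W a"
        using der by (meson DERIV_isCont continuous_at_imp_continuous_on)
      then have "a \<in> borel_measurable (restrict_space borel W)"
        by (rule borel_measurable_continuous_on_restrict)
      then have "(\<lambda>\<alpha>. F (a \<alpha>)) \<in> borel_measurable (restrict_space borel W)"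
        using F by measurable
      then show "(\<lambda>\<alpha>. F (a \<alpha>) * indicator W \<alpha>) \<in> borel_measurable lborel"
        using \<open>open W\<close> by (simp add: borel_measurable_restrict_space_iff_ennreal)
    qed
    also have "\<dots> \<le> (\<integral>\<^sup>+\<alpha>\<in>I. emeasure lebesgue (\<Phi> \<alpha> ` ?E) \<partial>lborel)"
    proof (rule nn_integral_mono)
      fix \<alpha>
      have "ennreal (inverse K) * F (a \<alpha>) \<le> emeasure lebesgue (\<Phi> \<alpha> ` ?E)" if "\<alpha> \<in> I"
      proof -
        have "ennreal (inverse K) * F (a \<alpha>) \<le> ennreal (inverse K) * (ennreal K * emeasure lebesgue (\<Phi> \<alpha> ` ?E))"
          using FG[OF that] by (rule mult_left_mono) simp
        also have "\<dots> = emeasure lebesgue (\<Phi> \<alpha> ` ?E)"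
        proof -
          have "ennreal (inverse K) * ennreal K = 1"
            using K ennreal_mult[of "inverse K" K] by simp
          then show ?thesis by (simp only: mult.assoc[symmetric] mult_1_left)
        qed
        finally show ?thesis .
      qed
      then show "ennreal (inverse K) * (F (a \<alpha>) * indicator W \<alpha>)
          \<le> emeasure lebesgue (\<Phi> \<alpha> ` ?E) * indicator I \<alpha>"
        by (auto simp: indicator_def W_def)
    qed
    also have "\<dots> = Fav I \<Phi> ?E"
      by (simp add: Fav_def nn_integral_completion)
    finally show ?thesis .
  qed
  moreover have "0 < 1 / (16 * C\<^sub>0\<^sup>2)"
    using C0 by simp
  ultimately show ?thesis
    using c by (intro exI[of _ "1 / (16 * C\<^sub>0\<^sup>2)"] exI[of _ c] conjI allI impI) auto
qed

end
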